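(* Let $t$ be a positive integer. For a positive integer $n$, let $pd_t(n)$ denote the number of partitions of $n$ in which all parts are distinct and the difference between the largest and smallest parts is at most $t$, and let $po_t(n)$ denote the number of partitions of $n$ in which all parts are odd and the difference between the largest and smallest parts is at most $t$ (so $po_{2t}(n)$ is the number of partitions of $n$ into odd parts with difference between largest and smallest parts at most $2t$). Then, for $|q|<1$, $$\sum_{n\ge 1}pd_t(n)\, q^n=\frac{1}{1-q^{t+1}}\left((-q;q)_{t+1}-1\right),$$ and $$\sum_{n\ge 1}po_{2t}(n)\, q^n=\frac{1}{1-q^{2t}}\left(\frac{1}{(q;q^2)_t}-1\right).$$
   Context: A partition of a positive integer $n$ is a non-increasing sequence of positive integers (its parts) whose sum is $n$. The $q$-Pochhammer symbol is $(a;q)_n:=\prod_{k=0}^{n-1}(1-aq^k)$ for $|q|<1$; thus $(-q;q)_{t+1}=\prod_{k=1}^{t+1}(1+q^k)$ and $(q;q^2)_t=\prod_{k=1}^{t}(1-q^{2k-1})$. *)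

theory Defs
  imports "HOL-Analysis.Analysis"
begin

definition is_partition :: "nat \<Rightarrow> nat list \<Rightarrow> bool" where
  "is_partition n xs \<longleftrightarrow> sorted_wrt (\<ge>) xs \<and> (\<forall>x\<in>set xs. 0 < x) \<and> sum_list xs = n"

(* Max and Min are only meaningful for nonempty lists, i.e. for n > 0; for n > 0 the
   natural-number subtraction never truncates. *)
definition part_spread :: "nat list \<Rightarrow> nat" where
  "part_spread xs = Max (set xs) - Min (set xs)"

definition pd :: "nat \<Rightarrow> nat \<Rightarrow> nat" where
  "pd t n = card {xs. is_partition n xs \<and> distinct xs \<and> part_spread xs \<le> t}"

definition po :: "nat \<Rightarrow> nat \<Rightarrow> nat" where
  "po t n = card {xs. is_partition n xs \<and> (\<forall>x\<in>set xs. odd x) \<and> part_spread xs \<le> t}"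

definition qpoch :: "'a::comm_ring_1 \<Rightarrow> 'a \<Rightarrow> nat \<Rightarrow> 'a" where
  "qpoch a q n = (\<Prod>k<n. 1 - a * q ^ k)"

(* The sets counted by pd and po are subsets of this one, so card is their true size. *)
lemma finite_partitions: "finite {xs. is_partition n xs}"
proof (rule finite_subset)
  show "finite {xs. set xs \<subseteq> {..n} \<and> length xs \<le> n}"
    by (rule finite_lists_length_le) simp
  have len: "length xs \<le> sum_list xs" if "\<forall>x\<in>set xs. 0 < x" for xs :: "nat list"
    using that by (induction xs) auto
  show "{xs. is_partition n xs} \<subseteq> {xs. set xs \<subseteq> {..n} \<and> length xs \<le> n}"
    using len by (auto simp: is_partition_def intro: member_le_sum_list)
qed

end

theory Submission
  imports Defs
begin

text \<open>
  Let d = t + 1 for distinct parts and d = 2t for odd parts, and regard partitions as multisets.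
  Replacing one copy of the smallest part m by m + d maps the nonempty multisets of spread at most d
  injectively onto those with a part exceeding d. It raises the sum by d and preserves the multiset
  of residues modulo d. Hence for every class of partitions defined by its residues, the generating
  function is 1/(1 - q^d) times the one for the nonempty multisets of parts in {1..d}. As d = 2t is
  even, oddness of the parts is such a condition; and distinct parts with spread at most t amount
  to distinct residues modulo t + 1 with spread at most t + 1.
\<close>

section \<open>Sums over products, geometric series and orbits of an injection\<close>

lemma has_sum_Times:
  fixes f :: "'a \<Rightarrow> complex" and g :: "'b \<Rightarrow> complex"
  assumes f: "(f has_sum S) A" and g: "(g has_sum T) B"
  shows "((\<lambda>(x, y). f x * g y) has_sum S * T) (A \<times> B)"
proof (rule has_sum_SigmaI)
  show "((\<lambda>y. (\<lambda>(x, y). f x * g y) (x, y)) has_sum f x * T) B" for x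
    using has_sum_cmult_right[OF g] by simp
  show "((\<lambda>x. f x * T) has_sum S * T) A"
    using has_sum_cmult_left[OF f] .
  \<comment> \<open>Summable complex families are absolutely summable, so the family of products is
    absolutely summable on the product set; this licenses the iterated summation.\<close>
  have "(\<lambda>x. norm (f x)) summable_on A" "(\<lambda>y. norm (g y)) summable_on B"
    using f g summable_on_iff_abs_summable_on_complex has_sum_imp_summable by blast+
  then have "(\<lambda>p. norm ((\<lambda>(x, y). f x * g y) p)) summable_on A \<times> B"
    unfolding Infinite_Sum.abs_summable_on_Sigma_iff
    by (simp add: norm_mult infsum_cmult_right' summable_on_cmult_right summable_on_cmult_left abs_mult)
  then show "(\<lambda>(x, y). f x * g y) summable_on A \<times> B"
    by (simp add: summable_on_iff_abs_summable_on_complex)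
qed

lemma has_sum_geometric:
  fixes z :: complex
  assumes "norm z < 1"
  shows "((\<lambda>n. z ^ n) has_sum 1 / (1 - z)) UNIV"
  using assms by (intro norm_summable_imp_has_sum) (auto simp: norm_power geometric_sums)

text \<open>Each element of \<open>A\<close> is \<open>(f ^^ k) b\<close> for exactly one
  \<open>b\<close> in \<open>B\<close> and one \<open>k\<close>: orbits cannot merge because
  \<open>f\<close> is injective, and they can start only in \<open>B\<close>. Along an orbit the
  weights grow by \<open>d\<close>, so a geometric series in \<open>q ^ d\<close> factors
  out.\<close>

lemma has_sum_orbits:
  fixes q :: complex and w :: "'a \<Rightarrow> nat"
  assumes inj: "inj_on f A" and A: "A = B \<union> f ` A" "B \<inter> f ` A = {}"
    and w: "\<And>x. x \<in> A \<Longrightarrow> w (f x) = w x + d" and "d > 0" and q: "norm q < 1"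
    and sum: "((\<lambda>x. q ^ w x) has_sum S) B"
  shows "((\<lambda>x. q ^ w x) has_sum 1 / (1 - q ^ d) * S) A"
proof -
  have B: "B \<subseteq> A" using A(1) by blast
  have funpow_A: "(f ^^ k) x \<in> A" if "x \<in> A" for k x
    using that A(1) by (induction k) auto
  have w_funpow: "w ((f ^^ k) x) = w x + k * d" if "x \<in> A" for k x
    by (induction k) (use that w funpow_A in auto)
  have cancel: "x = (f ^^ j) y" if "(f ^^ k) x = (f ^^ (k + j)) y" "x \<in> A" "y \<in> A" for k j x y
    using that by (induction k) (auto dest!: inj_onD[OF inj] simp: funpow_A)
  have not_B: "(f ^^ j) y \<notin> B" if "y \<in> A" "j > 0" for j y
    using A(2) funpow_A[OF that(1)] that(2) by (cases j) auto
  have inj': "x = y \<and> j = k" if "(f ^^ j) x = (f ^^ k) y" "x \<in> B" "y \<in> B" "j \<le> k" for x y j k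
    using cancel[of j x "k - j" y] not_B[of y "k - j"] that A(1) by (cases "j = k") auto
  have "bij_betw (\<lambda>(x, k). (f ^^ k) x) (B \<times> UNIV) A"
    unfolding bij_betw_def
  proof (intro conjI equalityI subsetI)
    show "inj_on (\<lambda>(x, k). (f ^^ k) x) (B \<times> UNIV)"
      by (auto simp: inj_on_def) (metis inj' nat_le_linear)+
    show "x \<in> A" if "x \<in> (\<lambda>(x, k). (f ^^ k) x) ` (B \<times> UNIV)" for x
      using that funpow_A A(1) by auto
    show "x \<in> (\<lambda>(x, k). (f ^^ k) x) ` (B \<times> UNIV)" if "x \<in> A" for x
      using that
    \<comment> \<open>Going back along \<open>f\<close> lowers the weight by \<open>d > 0\<close>,
      so the descent must stop, and it can stop only in \<open>B\<close>.\<close>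
    proof (induction "w x" arbitrary: x rule: less_induct)
      case less
      show ?case
      proof (cases "x \<in> B")
        case True
        then show ?thesis by (force intro: image_eqI[of _ _ "(x, 0)"])
      next
        case False
        then obtain y where y: "y \<in> A" "x = f y" using less.prems A(1) by auto
        then obtain b k where "b \<in> B" "y = (f ^^ k) b"
          using less.hyps[of y] w \<open>d > 0\<close> by auto
        then show ?thesis by (intro image_eqI[of _ _ "(b, Suc k)"]) (auto simp: y)
      qed
    qed
  qed
  moreover have "((\<lambda>(x, k). q ^ w x * (q ^ d) ^ k) has_sum S * (1 / (1 - q ^ d))) (B \<times> UNIV)"
    using q \<open>d > 0\<close>
    by (intro has_sum_Times sum has_sum_geometric) (simp add: norm_power power_less_one_iff)
  then have "((\<lambda>(x, k). q ^ w ((f ^^ k) x)) has_sum S * (1 / (1 - q ^ d))) (B \<times> UNIV)"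
    by (rule has_sum_cong[THEN iffD1, rotated])
      (use B in \<open>auto simp: w_funpow subset_eq power_add power_mult[symmetric] mult.commute\<close>)
  ultimately show ?thesis
    by (subst has_sum_reindex_bij_betw[symmetric]) (auto simp: case_prod_unfold mult.commute)
qed

section \<open>Multisets of bounded spread and the shift of the smallest part\<close>

definition windows :: "nat \<Rightarrow> nat multiset set" where
  "windows d = {M. M \<noteq> {#} \<and> (\<forall>x\<in>#M. 0 < x) \<and> (\<forall>x\<in>#M. \<forall>y\<in>#M. x \<le> y + d)}"

definition shift :: "nat \<Rightarrow> nat multiset \<Rightarrow> nat multiset" where
  "shift d M = add_mset (Min_mset M + d) (M - {#Min_mset M#})"

lemma sum_mset_shift:
  assumes "M \<noteq> {#}"
  shows "\<Sum>\<^sub># (shift d M) = \<Sum>\<^sub># M + d"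
proof -
  obtain N where "M = add_mset (Min_mset M) N"
    using Min_in_mset[OF assms] by (rule mset_add)
  then have "\<Sum>\<^sub># M = Min_mset M + \<Sum>\<^sub># N" "M - {#Min_mset M#} = N"
    by (metis sum_mset.add_mset, metis add_mset_remove_trivial)
  then show ?thesis by (simp add: shift_def)
qed

lemma mod_shift:
  assumes "M \<noteq> {#}"
  shows "image_mset (\<lambda>x. x mod d) (shift d M) = image_mset (\<lambda>x. x mod d) M"
proof -
  have "image_mset (\<lambda>x. x mod d) (shift d M) =
      image_mset (\<lambda>x. x mod d) (add_mset (Min_mset M) (M - {#Min_mset M#}))"
    by (simp only: shift_def image_mset_add_mset mod_add_self2)
  also have "add_mset (Min_mset M) (M - {#Min_mset M#}) = M"
    using assms by simp
  finally show ?thesis .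
qed

text \<open>With \<open>m\<close> the minimum, all parts lie between \<open>m\<close> and
  \<open>m + d\<close>, and this interval also contains the new part, as its right end. Hence the
  minimum of \<open>M\<close> can be read off from the maximum of the image, which is what
  injectivity needs.\<close>

lemma shift_windows:
  assumes "M \<in> windows d"
  shows "shift d M \<in> windows d" "Max_mset (shift d M) = Min_mset M + d"
proof -
  have M: "M \<noteq> {#}" "\<And>x. x \<in># M \<Longrightarrow> 0 < x" "\<And>x y. x \<in># M \<Longrightarrow> y \<in># M \<Longrightarrow> x \<le> y + d"
    using assms by (auto simp: windows_def)
  have min: "Min_mset M \<in># M" "\<And>x. x \<in># M \<Longrightarrow> Min_mset M \<le> x"
    using M(1) by auto
  show "shift d M \<in> windows d"
    using M min by (auto simp: windows_def shift_def dest!: in_diffD intro: trans_le_add1)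
  show "Max_mset (shift d M) = Min_mset M + d"
    using M min by (intro Max_eqI) (auto simp: shift_def dest!: in_diffD)
qed

lemma inj_on_shift: "inj_on (shift d) (windows d)"
proof (rule inj_onI)
  fix M N assume *: "M \<in> windows d" "N \<in> windows d" "shift d M = shift d N"
  then have "Min_mset M = Min_mset N"
    using shift_windows(2)[of M d] shift_windows(2)[of N d] by simp
  with *(3) have "M - {#Min_mset M#} = N - {#Min_mset M#}"
    by (simp add: shift_def)
  moreover have "Min_mset M \<in># M" "Min_mset M \<in># N"
    using * \<open>Min_mset M = Min_mset N\<close> Min_in_mset[of M] Min_in_mset[of N]
    by (auto simp: windows_def simp del: Min_in)
  ultimately show "M = N"
    by (metis insert_DiffM)
qed

text \<open>The inverse move replaces one copy of the largest part \<open>m\<close> by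
  \<open>m - d\<close>. This is positive since \<open>m\<close> exceeds \<open>d\<close>, and it is
  a smallest part since the window condition gives \<open>m \<le> y + d\<close> for every part
  \<open>y\<close>.\<close>

lemma shift_surj:
  assumes N: "N \<in> windows d" and x: "x \<in># N" "d < x"
  obtains M where "M \<in> windows d" "N = shift d M"
proof -
  define m where "m = Max_mset N"
  define M where "M = add_mset (m - d) (N - {#m#})"
  have max: "m \<in># N" "\<And>y. y \<in># N \<Longrightarrow> y \<le> m"
    using x(1) by (auto simp: m_def intro!: Max_in_mset)
  have "d < m" using max x by (meson less_le_trans)
  have le: "m \<le> y + d" if "y \<in># N" for y
    using N max(1) that by (auto simp: windows_def)
  have min: "Min_mset M = m - d"
    using le by (intro Min_eqI) (auto simp: M_def le_diff_conv dest: in_diffD)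
  have range: "m - d \<le> y \<and> y \<le> m" if "y \<in># M" for y
    using that max le by (auto simp: M_def le_diff_conv dest: in_diffD)
  have "x \<le> y + d" "0 < x" if "x \<in># M" "y \<in># M" for x y
    using range[OF that(1)] range[OF that(2)] \<open>d < m\<close> by linarith+
  then have "M \<in> windows d"
    by (auto simp: windows_def M_def)
  moreover have "N = shift d M"
    unfolding shift_def min using max(1) \<open>d < m\<close> by (simp add: M_def)
  ultimately show thesis by (rule that)
qed

text \<open>The shift leaves the multiset of residues unchanged, so it acts on the windows
  satisfying \<open>Q\<close>. Those outside its image are the ones with all parts at most
  \<open>d\<close>; they serve as the starting points of the orbits.\<close>

lemma has_sum_windows:
  fixes q :: complex
  assumes d: "d > 0" and q: "norm q < 1"
    and sum: "((\<lambda>M. q ^ \<Sum>\<^sub># M) has_sum S)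
      {M. M \<noteq> {#} \<and> set_mset M \<subseteq> {1..d} \<and> Q (image_mset (\<lambda>x. x mod d) M)}"
  shows "((\<lambda>M. q ^ \<Sum>\<^sub># M) has_sum 1 / (1 - q ^ d) * S)
    {M \<in> windows d. Q (image_mset (\<lambda>x. x mod d) M)}"
proof (rule has_sum_orbits[where f = "shift d", OF _ _ _ _ d q sum])
  let ?A = "{M \<in> windows d. Q (image_mset (\<lambda>x. x mod d) M)}"
  let ?B = "{M. M \<noteq> {#} \<and> set_mset M \<subseteq> {1..d} \<and> Q (image_mset (\<lambda>x. x mod d) M)}"
  have ne: "M \<noteq> {#}" if "M \<in> windows d" for M
    using that by (simp add: windows_def)
  show "inj_on (shift d) ?A"
    by (rule inj_on_subset[OF inj_on_shift]) auto
  show "?A = ?B \<union> shift d ` ?A"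
  proof (intro equalityI subsetI)
    fix N assume N: "N \<in> ?A"
    show "N \<in> ?B \<union> shift d ` ?A"
    proof (cases "\<exists>x\<in>#N. d < x")
      case True
      with N obtain M where "M \<in> windows d" "N = shift d M"
        by (auto elim: shift_surj)
      then show ?thesis using N by (auto simp: mod_shift[OF ne])
    next
      case False
      then show ?thesis using N by (force simp: windows_def)
    qed
  next
    fix N assume "N \<in> ?B \<union> shift d ` ?A"
    then show "N \<in> ?A"
      \<comment> \<open>Parts in \<open>{1..d}\<close> form a window automatically:
        \<open>x \<le> d \<le> y + d\<close>.\<close>
      by (auto simp: shift_windows mod_shift[OF ne]) (auto simp: windows_def subset_eq intro: trans_le_add2)
  qed
  \<comment> \<open>The part \<open>Min_mset M + d\<close> exceeds \<open>d\<close>, because parts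
    are positive.\<close>
  have "\<not> set_mset (shift d M) \<subseteq> {1..d}" if "M \<in> windows d" for M
  proof -
    have "0 < Min_mset M"
      using that Min_in_mset[of M] by (simp add: windows_def)
    then show ?thesis by (simp add: shift_def)
  qed
  then show "?B \<inter> shift d ` ?A = {}" by auto
  show "\<Sum>\<^sub># (shift d M) = \<Sum>\<^sub># M + d" if "M \<in> ?A" for M
    using that by (simp add: sum_mset_shift ne)
qed

section \<open>Generating functions of multisets with parts from a finite set\<close>

lemma has_sum_multisets:
  fixes f :: "'a \<Rightarrow> complex"
  assumes "finite K" and "\<And>k. k \<in> K \<Longrightarrow> norm (f k) < 1"
  shows "((\<lambda>M. \<Prod>\<^sub># (image_mset f M)) has_sum (\<Prod>k\<in>K. 1 / (1 - f k))) {M. set_mset M \<subseteq> K}"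
  using assms
proof (induction K rule: finite_induct)
  case empty
  have "{M. set_mset M \<subseteq> {}} = {{#}}" by auto
  then show ?case by (simp add: has_sum_finite_iff)
next
  case (insert a K)
  \<comment> \<open>A multiset over \<open>insert a K\<close> amounts to the multiplicity
    \<open>n\<close> of \<open>a\<close> together with a multiset over \<open>K\<close>; the
    multiplicity contributes the geometric factor \<open>1 / (1 - f a)\<close>.\<close>
  have "((\<lambda>(n, M). f a ^ n * \<Prod>\<^sub># (image_mset f M)) has_sum
      1 / (1 - f a) * (\<Prod>k\<in>K. 1 / (1 - f k))) (UNIV \<times> {M. set_mset M \<subseteq> K})"
    using insert by (intro has_sum_Times has_sum_geometric) auto
  also have "?this \<longleftrightarrow> ((\<lambda>M. \<Prod>\<^sub># (image_mset f M)) has_sum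
      1 / (1 - f a) * (\<Prod>k\<in>K. 1 / (1 - f k))) {M. set_mset M \<subseteq> insert a K}"
  proof (rule has_sum_reindex_bij_witness[where
        j = "\<lambda>(n, M). replicate_mset n a + M" and
        i = "\<lambda>M. (count M a, filter_mset (\<lambda>x. x \<noteq> a) M)"])
    fix p assume p: "p \<in> (UNIV :: nat set) \<times> {M. set_mset M \<subseteq> K}"
    obtain n M where [simp]: "p = (n, M)" by (cases p)
    have "a \<notin># M" using p insert.hyps by auto
    then show "(\<lambda>M. (count M a, filter_mset (\<lambda>x. x \<noteq> a) M))
        ((\<lambda>(n, M). replicate_mset n a + M) p) = p"
      by (auto simp: not_in_iff filter_mset_eq_conv intro!: multiset_eqI split: if_splits)
  next
    fix M :: "'a multiset"
    show "(\<lambda>(n, M). replicate_mset n a + M) (count M a, filter_mset (\<lambda>x. x \<noteq> a) M) = M"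
      by (auto intro!: multiset_eqI)
  qed (auto simp: image_replicate_mset split: if_splits)
  finally show ?case using insert.hyps by simp
qed

lemma has_sum_nonempty:
  fixes q :: complex
  assumes "((\<lambda>M. q ^ \<Sum>\<^sub># M) has_sum S) A" and "{#} \<in> A"
  shows "((\<lambda>M. q ^ \<Sum>\<^sub># M) has_sum (S - 1)) (A - {{#}})"
  by (rule has_sum_Diff) (use assms in \<open>auto simp: has_sum_finite_iff\<close>)

lemma power_sum_mset: "q ^ \<Sum>\<^sub># M = \<Prod>\<^sub># (image_mset (\<lambda>k. q ^ k) M)" for q :: "'a::comm_monoid_mult"
  by (induction M) (auto simp: power_add)

text \<open>Expanding the product chooses a subset of \<open>K\<close>, and \<open>mset_set\<close>
  identifies subsets with multisets without repetition. The latter are described by a size equation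
  so that the same predicate can also be applied to a multiset of residues.\<close>

lemma has_sum_distinct_multisets:
  fixes q :: complex
  assumes "finite K"
  shows "((\<lambda>M. q ^ \<Sum>\<^sub># M) has_sum (\<Prod>k\<in>K. 1 + q ^ k))
    {M. set_mset M \<subseteq> K \<and> size M = card (set_mset M)}"
proof -
  have fin: "finite X" if "X \<subseteq> K" for X
    using assms finite_subset that by blast
  have "(\<Prod>k\<in>K. q ^ k + 1) = (\<Sum>X\<in>Pow K. q ^ \<Sum>X)"
    by (simp add: prod_add assms power_sum)
  then have "((\<lambda>X. q ^ \<Sum>X) has_sum (\<Prod>k\<in>K. 1 + q ^ k)) (Pow K)"
    using assms by (simp add: has_sum_finite_iff add.commute)
  also have "?this \<longleftrightarrow> ?thesis"
  proof (rule has_sum_reindex_bij_witness[where j = mset_set and i = set_mset])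
    fix M :: "nat multiset" assume "M \<in> {M. set_mset M \<subseteq> K \<and> size M = card (set_mset M)}"
    then have "size (mset_set (set_mset M)) = size M" by simp
    \<comment> \<open>A submultiset of the same size is the whole multiset.\<close>
    moreover have "mset_set (set_mset M) \<subseteq># M"
      by (simp add: mset_set_set_mset_msubset)
    ultimately show "mset_set (set_mset M) = M"
      by (metis mset_subset_size nless_le subset_mset.le_less)
  qed (auto simp: fin sum_unfold_sum_mset)
  finally show ?thesis .
qed

section \<open>From multisets to partitions as non-increasing lists\<close>

lemma has_sum_partitions:
  fixes q :: complex
  assumes "((\<lambda>M. q ^ \<Sum>\<^sub># M) has_sum S) {M. M \<noteq> {#} \<and> (\<forall>x\<in>#M. 0 < x) \<and> P M}"
  shows "((\<lambda>n. of_nat (card {xs. is_partition n xs \<and> P (mset xs)}) * q ^ n) has_sum S) {1..}"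
proof -
  let ?F = "\<lambda>n. {xs. is_partition n xs \<and> P (mset xs)}"
  have "((\<lambda>M. q ^ \<Sum>\<^sub># M) has_sum S) {M. M \<noteq> {#} \<and> (\<forall>x\<in>#M. 0 < x) \<and> P M} \<longleftrightarrow>
    ((\<lambda>(n, xs). q ^ n) has_sum S) (Sigma {1..} ?F)"
  proof (rule has_sum_reindex_bij_witness[where i = "\<lambda>(n, xs). mset xs" and
        j = "\<lambda>M. (\<Sum>\<^sub># M, rev (sorted_list_of_multiset M))"])
    fix p assume "p \<in> Sigma {1..} ?F"
    then obtain n xs where p: "p = (n, xs)" "1 \<le> n" "is_partition n xs" "P (mset xs)" by auto
    have "sorted (rev xs)"
      using p(3) by (simp add: is_partition_def sorted_wrt_rev)
    then have "rev (sorted_list_of_multiset (mset xs)) = xs"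
      by (metis mset_rev rev_rev_ident sorted_list_of_multiset_mset sorted_sort_id)
    then show "(\<lambda>M. (\<Sum>\<^sub># M, rev (sorted_list_of_multiset M))) ((\<lambda>(n, xs). mset xs) p) = p"
      using p by (simp add: is_partition_def sum_mset_sum_list)
    show "(\<lambda>(n, xs). mset xs) p \<in> {M. M \<noteq> {#} \<and> (\<forall>x\<in>#M. 0 < x) \<and> P M}"
      using p by (auto simp: is_partition_def)
  next
    fix M :: "nat multiset" assume M: "M \<in> {M. M \<noteq> {#} \<and> (\<forall>x\<in>#M. 0 < x) \<and> P M}"
    obtain x where "x \<in># M" using M by auto
    \<comment> \<open>Positivity of the parts keeps nonempty multisets out of the fibre over 0,
      matching the index set \<open>{1..}\<close>.\<close>
    with M have "\<Sum>\<^sub># M \<noteq> 0" by (auto simp: sum_mset_0_iff)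
    then have "1 \<le> \<Sum>\<^sub># M" by linarith
    then show "(\<Sum>\<^sub># M, rev (sorted_list_of_multiset M)) \<in> Sigma {1..} ?F"
      using M by (auto simp: is_partition_def sorted_wrt_rev sum_mset_sum_list[symmetric])
  qed auto
  then have "((\<lambda>(n, xs). q ^ n) has_sum S) (Sigma {1..} ?F)" using assms by simp
  then show ?thesis
  proof (rule has_sum_SigmaD)
    fix n
    have "finite (?F n)" by (rule finite_subset[OF _ finite_partitions[of n]]) auto
    then show "((\<lambda>xs. (\<lambda>(n, xs). q ^ n) (n, xs)) has_sum of_nat (card (?F n)) * q ^ n) (?F n)"
      by (simp add: has_sum_finite_iff)
  qed
qed

text \<open>Replaces the truncated difference of extremes by the pairwise inequalities used for
  windows. Nonemptiness ensures that both extremes are actual parts.\<close>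

lemma spread_le_iff:
  assumes "xs \<noteq> []"
  shows "part_spread xs \<le> t \<longleftrightarrow> (\<forall>x\<in>set xs. \<forall>y\<in>set xs. x \<le> y + t)"
proof
  assume *: "part_spread xs \<le> t"
  show "\<forall>x\<in>set xs. \<forall>y\<in>set xs. x \<le> y + t"
  proof (intro ballI)
    fix x y assume "x \<in> set xs" "y \<in> set xs"
    then have "x \<le> Max (set xs)" "Min (set xs) \<le> y" by auto
    with * show "x \<le> y + t" by (simp add: part_spread_def)
  qed
next
  assume "\<forall>x\<in>set xs. \<forall>y\<in>set xs. x \<le> y + t"
  moreover have "Max (set xs) \<in> set xs" "Min (set xs) \<in> set xs"
    using assms by auto
  ultimately show "part_spread xs \<le> t"
    unfolding part_spread_def le_diff_conv by (metis add.commute)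
qed

text \<open>Within a spread of \<open>t + 1\<close>, two entries congruent modulo
  \<open>t + 1\<close> are either equal or exactly \<open>t + 1\<close> apart. Distinct residues
  exclude both cases, so they force distinct entries and lower the bound on the spread to
  \<open>t\<close>; conversely, a spread of at most \<open>t\<close> leaves only equality.\<close>

lemma distinct_mod_iff:
  assumes xs: "xs \<noteq> []"
  shows "distinct (map (\<lambda>x. x mod Suc t) xs) \<and> (\<forall>x\<in>set xs. \<forall>y\<in>set xs. x \<le> y + Suc t) \<longleftrightarrow>
    distinct xs \<and> (\<forall>x\<in>set xs. \<forall>y\<in>set xs. x \<le> y + t)"
    (is "?L \<longleftrightarrow> ?R")
proof
  assume L: ?L
  have "x \<le> y + t" if "x \<in> set xs" "y \<in> set xs" for x y
  proof (rule ccontr)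
    assume "\<not> x \<le> y + t"
    with L that have "x = y + Suc t" by (metis le_antisym not_less_eq_eq add_Suc_right)
    with L that show False
      using inj_onD[of "\<lambda>x. x mod Suc t" "set xs" x y] mod_add_self2[of y "Suc t"]
      by (simp add: distinct_map del: mod_add_self2)
  qed
  with L show ?R by (auto simp: distinct_map)
next
  assume R: ?R
  have *: "x = y" if "x \<in> set xs" "y \<in> set xs" "x mod Suc t = y mod Suc t" "x \<le> y" for x y
  proof -
    have "Suc t dvd y - x" using that mod_eq_dvd_iff_nat[of x y "Suc t"] by simp
    moreover have "y - x < Suc t" using R that by (metis le_diff_conv add.commute le_imp_less_Suc)
    ultimately show ?thesis using that(4) by (auto dest: dvd_imp_le)
  qed
  have "inj_on (\<lambda>x. x mod Suc t) (set xs)"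
    by (rule inj_onI) (metis * nat_le_linear)
  with R show ?L by (auto simp: distinct_map intro: le_SucI)
qed

text \<open>Reduces a counting problem for lists to a sum over multisets with parts in
  \<open>{1..d}\<close>. The condition \<open>R\<close> has to be translated for nonempty lists
  only, since the sum starts at \<open>n = 1\<close> and the empty list is a partition of 0.\<close>

lemma has_sum_windowed_partitions:
  fixes q :: complex
  assumes "d > 0" and "norm q < 1"
    and "((\<lambda>M. q ^ \<Sum>\<^sub># M) has_sum S)
      {M. M \<noteq> {#} \<and> set_mset M \<subseteq> {1..d} \<and> Q (image_mset (\<lambda>x. x mod d) M)}"
    and R: "\<And>xs. xs \<noteq> [] \<Longrightarrow> R xs \<longleftrightarrow>
      (\<forall>x\<in>set xs. \<forall>y\<in>set xs. x \<le> y + d) \<and> Q (image_mset (\<lambda>x. x mod d) (mset xs))"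
  shows "((\<lambda>n. of_nat (card {xs. is_partition n xs \<and> R xs}) * q ^ n) has_sum
    1 / (1 - q ^ d) * S) {1..}"
proof -
  let ?P = "\<lambda>M. (\<forall>x\<in>#M. \<forall>y\<in>#M. x \<le> y + d) \<and> Q (image_mset (\<lambda>x. x mod d) M)"
  have "((\<lambda>M. q ^ \<Sum>\<^sub># M) has_sum 1 / (1 - q ^ d) * S)
      {M. M \<noteq> {#} \<and> (\<forall>x\<in>#M. 0 < x) \<and> ?P M}"
    using has_sum_windows[OF assms(1-3)] by (simp add: windows_def conj_ac)
  then have "((\<lambda>n. of_nat (card {xs. is_partition n xs \<and> ?P (mset xs)}) * q ^ n) has_sum
      1 / (1 - q ^ d) * S) {1..}"
    by (rule has_sum_partitions)
  moreover have "is_partition n xs \<and> R xs \<longleftrightarrow> is_partition n xs \<and> ?P (mset xs)" if "n \<ge> 1" for n xs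
  proof (cases "xs = []")
    case True
    with that show ?thesis by (simp add: is_partition_def)
  qed (simp add: R)
  then have "card {xs. is_partition n xs \<and> R xs} = card {xs. is_partition n xs \<and> ?P (mset xs)}"
    if "n \<in> {1..}" for n
    using that by simp
  ultimately show ?thesis
    by (subst has_sum_cong) auto
qed

section \<open>Distinct parts via residues modulo \<open>t + 1\<close>, odd parts via residues
  modulo \<open>2 * t\<close>\<close>

theorem theorem1p1:
  fixes t :: nat and q :: complex
  assumes "t > 0" and "norm q < 1"
  shows "((\<lambda>n. of_nat (pd t n) * q ^ n) has_sum
           (1 / (1 - q ^ (t + 1)) * (qpoch (- q) q (t + 1) - 1))) {1..}
       \<and> ((\<lambda>n. of_nat (po (2 * t) n) * q ^ n) has_sum
           (1 / (1 - q ^ (2 * t)) * (1 / qpoch q (q ^ 2) t - 1))) {1..}"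
proof (intro conjI)
  let ?D = "\<lambda>R :: nat multiset. size R = card (set_mset R)"
  have distinct_iff: "distinct xs \<longleftrightarrow> ?D (mset xs)" for xs
    by (metis card_distinct distinct_card set_mset_mset size_mset)
  \<comment> \<open>\<open>{1..t + 1}\<close> is a complete residue system: only
    \<open>t + 1\<close> is changed by reduction, to 0. So for multisets inside it, having distinct
    elements and having distinct residues agree.\<close>
  have mod_inj: "inj_on (\<lambda>x. x mod (t + 1)) {1..t + 1}"
  proof (rule inj_onI)
    fix x y assume "x \<in> {1..t + 1}" "y \<in> {1..t + 1}" "x mod (t + 1) = y mod (t + 1)"
    then show "x = y" by (cases "x = t + 1"; cases "y = t + 1") auto
  qed
  have "((\<lambda>M. q ^ \<Sum>\<^sub># M) has_sum (\<Prod>k\<in>{1..t + 1}. 1 + q ^ k) - 1)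
      ({M. set_mset M \<subseteq> {1..t + 1} \<and> ?D M} - {{#}})"
    by (intro has_sum_nonempty has_sum_distinct_multisets) auto
  also have "{M. set_mset M \<subseteq> {1..t + 1} \<and> ?D M} - {{#}} =
      {M. M \<noteq> {#} \<and> set_mset M \<subseteq> {1..t + 1} \<and> ?D (image_mset (\<lambda>x. x mod (t + 1)) M)}"
    using card_image[OF inj_on_subset[OF mod_inj]] by auto
  \<comment> \<open>The factor of \<open>qpoch\<close> with index \<open>i\<close> is
    \<open>1 - (- q) * q ^ i\<close>, which is \<open>1 + q ^ Suc i\<close>; hence the reindexing by
    \<open>Suc\<close>.\<close>
  also have "(\<Prod>k\<in>{1..t + 1}. 1 + q ^ k) = qpoch (- q) q (t + 1)"
    unfolding qpoch_def image_Suc_lessThan[symmetric] by (subst prod.reindex) auto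
  finally have D: "((\<lambda>M. q ^ \<Sum>\<^sub># M) has_sum qpoch (- q) q (t + 1) - 1)
      {M. M \<noteq> {#} \<and> set_mset M \<subseteq> {1..t + 1} \<and> ?D (image_mset (\<lambda>x. x mod (t + 1)) M)}" .
  show "((\<lambda>n. of_nat (pd t n) * q ^ n) has_sum
      (1 / (1 - q ^ (t + 1)) * (qpoch (- q) q (t + 1) - 1))) {1..}"
    unfolding pd_def
  proof (rule has_sum_windowed_partitions[OF _ assms(2) D])
    fix xs :: "nat list" assume "xs \<noteq> []"
    then show "(distinct xs \<and> part_spread xs \<le> t) \<longleftrightarrow> (\<forall>x\<in>set xs. \<forall>y\<in>set xs. x \<le> y + (t + 1)) \<and>
        ?D (image_mset (\<lambda>x. x mod (t + 1)) (mset xs))"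
      using distinct_mod_iff[of xs t] distinct_iff[of "map (\<lambda>x. x mod (t + 1)) xs"]
      by (auto simp: spread_le_iff)
  qed simp
next
  let ?K = "(\<lambda>k. 2 * k + 1) ` {..<t}"
  \<comment> \<open>The modulus is even, so reduction preserves parity.\<close>
  have odd_mod: "odd (x mod (2 * t)) \<longleftrightarrow> odd x" for x :: nat
    by (simp add: dvd_mod_iff)
  have K: "?K = {x \<in> {1..2 * t}. odd x}"
    by (auto elim!: oddE)
  have "((\<lambda>M. q ^ \<Sum>\<^sub># M) has_sum (\<Prod>k\<in>?K. 1 / (1 - q ^ k))) {M. set_mset M \<subseteq> ?K}"
    unfolding power_sum_mset using assms(2)
    by (intro has_sum_multisets) (auto simp: norm_power power_less_one_iff simp del: power_Suc)
  then have "((\<lambda>M. q ^ \<Sum>\<^sub># M) has_sum (\<Prod>k\<in>?K. 1 / (1 - q ^ k)) - 1) ({M. set_mset M \<subseteq> ?K} - {{#}})"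
    by (rule has_sum_nonempty) auto
  also have "{M. set_mset M \<subseteq> ?K} - {{#}} = {M. M \<noteq> {#} \<and> set_mset M \<subseteq> {1..2 * t} \<and>
      (\<forall>r\<in>#image_mset (\<lambda>x. x mod (2 * t)) M. odd r)}"
    unfolding K by (auto simp: odd_mod)
  \<comment> \<open>For the exponent \<open>2 * k + 1\<close>, the power is
    \<open>q * (q ^ 2) ^ k\<close>, as in the factor of \<open>qpoch\<close> with index
    \<open>k\<close>.\<close>
  also have "(\<Prod>k\<in>?K. 1 / (1 - q ^ k)) = 1 / qpoch q (q ^ 2) t"
    by (subst prod.reindex) (auto simp: inj_on_def qpoch_def prod_dividef power_mult)
  finally have O: "((\<lambda>M. q ^ \<Sum>\<^sub># M) has_sum 1 / qpoch q (q ^ 2) t - 1)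
      {M. M \<noteq> {#} \<and> set_mset M \<subseteq> {1..2 * t} \<and>
        (\<forall>r\<in>#image_mset (\<lambda>x. x mod (2 * t)) M. odd r)}" .
  show "((\<lambda>n. of_nat (po (2 * t) n) * q ^ n) has_sum
      (1 / (1 - q ^ (2 * t)) * (1 / qpoch q (q ^ 2) t - 1))) {1..}"
    unfolding po_def
  proof (rule has_sum_windowed_partitions[OF _ assms(2) O])
    show "2 * t > 0" using assms(1) by simp
    fix xs :: "nat list" assume "xs \<noteq> []"
    then show "((\<forall>x\<in>set xs. odd x) \<and> part_spread xs \<le> 2 * t) \<longleftrightarrow>
        (\<forall>x\<in>set xs. \<forall>y\<in>set xs. x \<le> y + 2 * t) \<and>
        (\<forall>r\<in>#image_mset (\<lambda>x. x mod (2 * t)) (mset xs). odd r)"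
      by (simp add: spread_le_iff odd_mod conj_commute)
  qed
qed

end
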